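(* Let $p$ be a prime and $n\ge2$ an integer with $(p-1)(n-1)>2$. Let $(S,H)$ be a generalized Fermat pair of type $(p,n)$ with standard set of generators $\{a_1,\ldots,a_{n+1}\}$ of $H$. Let $K<H$ be a subgroup with $K\neq\{I\}$ ($I$ the identity). Then $K$ acts freely on $S$ if and only if there are some $r\in A_{n,p}$ and some $P\in\mathcal F^n_{r,p}$ such that $K=K_P$.
   Context: For integers $n,p\ge2$ with $(p-1)(n-1)>2$, a generalized Fermat pair of type $(p,n)$ is a pair $(S,H)$, where $S$ is a closed Riemann surface and $H\cong\mathbb Z_p^n$ is a group of conformal automorphisms of $S$ such that $S/H$ has genus zero and exactly $n+1$ cone points, each of order $p$. A standard set of generators of $H$ is a set $\{a_1,\ldots,a_{n+1}\}\subset H$ such that each $a_j$ has order $p$, $a_1a_2\cdots a_{n+1}=1$, $H=\langle a_1,\ldots,a_n\rangle$, every non-trivial element of $H$ having fixed points on $S$ is a power of some $a_j$, and each $a_j$ has fixed points on $S$. (Concretely, one may take $S=C^p(\lambda_1,\ldots,\lambda_{n-2})\subset\mathbb P^n$ given by $x_1^p+x_2^p+x_3^p=0$, $\lambda_jx_1^p+x_2^p+x_{j+3}^p=0$ for $j=1,\ldots,n-2$, with $\lambda_1,\ldots,\lambda_{n-2}\in\mathbb C\setminus\{0,1\}$ pairwise distinct, where $a_j$ multiplies the coordinate $x_j$ by $e^{2\pi i/p}$.) For each $r\ge1$ fix an ordering $\mathbb Z_p^r=\{u_0=1,u_1,\ldots,u_{p^r-1}\}$ (written multiplicatively). For $r\in\{1,\ldots,n-1\}$,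 let $\mathcal F^n_{r,p}$ be the collection of tuples $(I_1,\ldots,I_{p^r-1})$ of pairwise disjoint (possibly empty) subsets of $\{1,\ldots,n+1\}$ with union $\{1,\ldots,n+1\}$ such that (i) $u_1^{\#I_1}\cdots u_{p^r-1}^{\#I_{p^r-1}}=1$, and (ii) $\langle u_k: k\in\{1,\ldots,p^r-1\},\ I_k\ne\varnothing\rangle=\mathbb Z_p^r$. Set $A_{n,p}=\{r\in\{1,\ldots,n-1\}:\mathcal F^n_{r,p}\neq\varnothing\}$. For $r\in A_{n,p}$ and $P=(I_1,\ldots,I_{p^r-1})\in\mathcal F^n_{r,p}$, let $\rho_{r,P}:H\to\mathbb Z_p^r$ be the surjective homomorphism defined by $\rho_{r,P}(a_j)=u_k$ for $j\in I_k$, and let $K_P$ be its kernel. *)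

theory Defs
  imports
    "HOL-Analysis.Abstract_Topological_Spaces"
    "HOL-Analysis.Complex_Analysis_Basics"
    "HOL-Homology.Homology"
    "HOL-Algebra.Group_Action"
    "HOL-Algebra.Multiplicative_Group"
    "HOL-Algebra.Product_Groups"
    "HOL-Algebra.Free_Abelian_Groups"
    "HOL-Computational_Algebra.Primes"
begin

text \<open>A chart is a coordinate domain together with a complex coordinate on it. Only the values
  of the coordinate on the domain matter.\<close>

type_synonym 'a chart = "'a set \<times> ('a \<Rightarrow> complex)"

definition complex_atlas :: "'a topology \<Rightarrow> 'a chart set \<Rightarrow> bool" where
  "complex_atlas X \<A> \<longleftrightarrow>
     (\<Union>(U, \<phi>) \<in> \<A>. U) = topspace X \<and>
     (\<forall>(U, \<phi>) \<in> \<A>. openin X U \<and> open (\<phi> ` U) \<and>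
        homeomorphic_map (subtopology X U) (top_of_set (\<phi> ` U)) \<phi>) \<and>
     (\<forall>(U, \<phi>) \<in> \<A>. \<forall>(V, \<psi>) \<in> \<A>. (\<psi> \<circ> inv_into U \<phi>) holomorphic_on \<phi> ` (U \<inter> V))"

definition riemann_surface :: "'a topology \<Rightarrow> 'a chart set \<Rightarrow> bool" where
  "riemann_surface X \<A> \<longleftrightarrow>
     topspace X \<noteq> {} \<and> connected_space X \<and> Hausdorff_space X \<and> second_countable X \<and>
     complex_atlas X \<A>"

definition closed_riemann_surface :: "'a topology \<Rightarrow> 'a chart set \<Rightarrow> bool" where
  "closed_riemann_surface X \<A> \<longleftrightarrow> riemann_surface X \<A> \<and> compact_space X"

definition holomorphic_self_map :: "'a topology \<Rightarrow> 'a chart set \<Rightarrow> ('a \<Rightarrow> 'a) \<Rightarrow> bool" where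
  "holomorphic_self_map X \<A> f \<longleftrightarrow>
     continuous_map X X f \<and>
     (\<forall>(U, \<phi>) \<in> \<A>. \<forall>(V, \<psi>) \<in> \<A>.
        (\<psi> \<circ> f \<circ> inv_into U \<phi>) holomorphic_on \<phi> ` {x \<in> U. f x \<in> V})"

text \<open>Automorphisms are biholomorphic self-maps, represented by functions that are
  extensional on the surface, so that they form a subset of the library's symmetric group
  \<open>BijGroup (topspace X)\<close>.\<close>

definition conformal_automorphisms :: "'a topology \<Rightarrow> 'a chart set \<Rightarrow> ('a \<Rightarrow> 'a) set" where
  "conformal_automorphisms X \<A> =
     {f \<in> Bij (topspace X). holomorphic_self_map X \<A> f \<and>
        holomorphic_self_map X \<A> (inv\<^bsub>BijGroup (topspace X)\<^esub> f)}"

abbreviation transformation_group :: "'a topology \<Rightarrow> ('a \<Rightarrow> 'a) set \<Rightarrow> ('a \<Rightarrow> 'a) monoid" where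
  "transformation_group X H \<equiv> (BijGroup (topspace X))\<lparr>carrier := H\<rparr>"

definition conformal_group_on ::
    "'a topology \<Rightarrow> 'a chart set \<Rightarrow> ('a \<Rightarrow> 'a) set \<Rightarrow> bool" where
  "conformal_group_on X \<A> H \<longleftrightarrow>
     subgroup H (BijGroup (topspace X)) \<and> H \<subseteq> conformal_automorphisms X \<A>"

definition has_fixed_point :: "'a topology \<Rightarrow> ('a \<Rightarrow> 'a) \<Rightarrow> bool" where
  "has_fixed_point X f \<longleftrightarrow> (\<exists>x \<in> topspace X. f x = x)"

definition acts_freely :: "'a topology \<Rightarrow> ('a \<Rightarrow> 'a) set \<Rightarrow> bool" where
  "acts_freely X K \<longleftrightarrow>
     (\<forall>k \<in> K. k \<noteq> \<one>\<^bsub>BijGroup (topspace X)\<^esub> \<longrightarrow> \<not> has_fixed_point X k)"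

definition surface_orbits :: "'a topology \<Rightarrow> ('a \<Rightarrow> 'a) set \<Rightarrow> 'a set set" where
  "surface_orbits X H = orbits (transformation_group X H) (topspace X) (\<lambda>h. h)"

definition orbit_space :: "'a topology \<Rightarrow> ('a \<Rightarrow> 'a) set \<Rightarrow> 'a set topology" where
  "orbit_space X H =
     topology (\<lambda>\<O>. \<O> \<subseteq> surface_orbits X H \<and> openin X (\<Union>\<O>))"

text \<open>For a closed orientable surface \<open>Y\<close>, the first integral homology group is free abelian
  of rank twice the genus.\<close>

definition has_genus :: "'a topology \<Rightarrow> nat \<Rightarrow> bool" where
  "has_genus Y g \<longleftrightarrow> homology_group 1 Y \<cong> free_Abelian_group {..<2 * g}"

text \<open>The cone points of the quotient orbifold are the orbits of points with non-trivial
  stabilizer; the order of a cone point is the order of the stabilizer of any point over it.\<close>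

definition stabilizer_of :: "'a topology \<Rightarrow> ('a \<Rightarrow> 'a) set \<Rightarrow> 'a \<Rightarrow> ('a \<Rightarrow> 'a) set" where
  "stabilizer_of X H x = stabilizer (transformation_group X H) (\<lambda>h. h) x"

definition cone_points :: "'a topology \<Rightarrow> ('a \<Rightarrow> 'a) set \<Rightarrow> 'a set set" where
  "cone_points X H =
     {orbit (transformation_group X H) (\<lambda>h. h) x | x.
        x \<in> topspace X \<and> stabilizer_of X H x \<noteq> {\<one>\<^bsub>BijGroup (topspace X)\<^esub>}}"

definition cone_points_have_order :: "'a topology \<Rightarrow> ('a \<Rightarrow> 'a) set \<Rightarrow> nat \<Rightarrow> bool" where
  "cone_points_have_order X H m \<longleftrightarrow>
     (\<forall>Q \<in> cone_points X H. \<forall>x \<in> Q. card (stabilizer_of X H x) = m)"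

lemma group_action_transformation_group:
  assumes "subgroup H (BijGroup (topspace X))"
  shows "group_action (transformation_group X H) (topspace X) (\<lambda>h. h)"
proof -
  interpret B: group "BijGroup (topspace X)"
    by (rule group_BijGroup)
  have "group (transformation_group X H)"
    using assms by (rule B.subgroup_imp_group)
  moreover have "(\<lambda>h. h) \<in> hom (transformation_group X H) (BijGroup (topspace X))"
    using subgroup.subset [OF assms] by (auto simp: hom_def)
  ultimately show ?thesis
    by (simp add: group_action_def group_hom_def group_hom_axioms_def group_BijGroup)
qed

lemma istopology_orbit_space:
  assumes "subgroup H (BijGroup (topspace X))"
  shows "istopology (\<lambda>\<O>. \<O> \<subseteq> surface_orbits X H \<and> openin X (\<Union>\<O>))"
  unfolding istopology_def
proof (intro conjI allI impI)
  interpret group_action "transformation_group X H" "topspace X" "\<lambda>h. h"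
    using assms by (rule group_action_transformation_group)
  fix S T
  assume ST: "S \<subseteq> surface_orbits X H \<and> openin X (\<Union>S)"
    "T \<subseteq> surface_orbits X H \<and> openin X (\<Union>T)"
  have "\<Union>(S \<inter> T) = \<Union>S \<inter> \<Union>T"
    using ST disjoint_union unfolding surface_orbits_def by blast
  then show "openin X (\<Union>(S \<inter> T))"
    using ST by (simp add: openin_Int)
  show "S \<inter> T \<subseteq> surface_orbits X H"
    using ST by blast
next
  fix K
  assume K: "\<forall>S\<in>K. S \<subseteq> surface_orbits X H \<and> openin X (\<Union>S)"
  then show "\<Union>K \<subseteq> surface_orbits X H"
    by blast
  have "\<Union>(\<Union>K) = (\<Union>S\<in>K. \<Union>S)"
    by blast
  then show "openin X (\<Union>(\<Union>K))"
    using K by (metis (no_types, lifting) openin_Union imageE)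
qed

lemma quotient_map_orbit_space:
  assumes "subgroup H (BijGroup (topspace X))"
  shows "quotient_map X (orbit_space X H) (orbit (transformation_group X H) (\<lambda>h. h))"
proof -
  interpret group_action "transformation_group X H" "topspace X" "\<lambda>h. h"
    using assms by (rule group_action_transformation_group)
  let ?q = "orbit (transformation_group X H) (\<lambda>h. h)"
  have op: "openin (orbit_space X H) \<O> \<longleftrightarrow> \<O> \<subseteq> surface_orbits X H \<and> openin X (\<Union>\<O>)" for \<O>
    unfolding orbit_space_def using istopology_orbit_space [OF assms]
    by (simp add: topology_inverse')
  have cover: "\<Union>(surface_orbits X H) = topspace X"
    unfolding surface_orbits_def by (rule orbits_coverture)
  have "openin (orbit_space X H) (surface_orbits X H)"
    by (simp add: op cover)
  then have top: "topspace (orbit_space X H) = surface_orbits X H"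
    by (metis op openin_subset openin_topspace subset_antisym)
  have img: "?q ` topspace X = surface_orbits X H"
    by (auto simp: surface_orbits_def orbits_def)
  have pre: "{x \<in> topspace X. ?q x \<in> \<O>} = \<Union>\<O>" if "\<O> \<subseteq> surface_orbits X H" for \<O>
  proof (intro subset_antisym subsetI)
    fix x assume "x \<in> {x \<in> topspace X. ?q x \<in> \<O>}"
    then show "x \<in> \<Union>\<O>"
      using orbit_refl by blast
  next
    fix x assume "x \<in> \<Union>\<O>"
    then obtain Q where Q: "Q \<in> \<O>" "x \<in> Q"
      by blast
    with that cover have x: "x \<in> topspace X"
      by blast
    have "?q x \<in> orbits (transformation_group X H) (topspace X) (\<lambda>h. h)"
      using x by (auto simp: orbits_def)
    moreover have "Q \<in> orbits (transformation_group X H) (topspace X) (\<lambda>h. h)"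
      using Q that by (auto simp: surface_orbits_def)
    ultimately have "?q x = Q"
      using disjoint_union orbit_refl [OF x] Q by blast
    with x Q show "x \<in> {x \<in> topspace X. ?q x \<in> \<O>}"
      by simp
  qed
  show ?thesis
    unfolding quotient_map_def using img pre by (simp add: top op)
qed

definition Zpow :: "nat \<Rightarrow> nat \<Rightarrow> (nat \<Rightarrow> int) monoid" where
  "Zpow p r = product_group {..<r} (\<lambda>_. integer_mod_group p)"

definition generalized_Fermat_pair ::
    "nat \<Rightarrow> nat \<Rightarrow> 'a topology \<Rightarrow> 'a chart set \<Rightarrow> ('a \<Rightarrow> 'a) set \<Rightarrow> bool" where
  "generalized_Fermat_pair p n X \<A> H \<longleftrightarrow>
     2 \<le> p \<and> 2 \<le> n \<and> (p - 1) * (n - 1) > 2 \<and>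
     closed_riemann_surface X \<A> \<and>
     conformal_group_on X \<A> H \<and>
     transformation_group X H \<cong> Zpow p n \<and>
     has_genus (orbit_space X H) 0 \<and>
     card (cone_points X H) = n + 1 \<and> cone_points_have_order X H p"

definition standard_generators ::
    "nat \<Rightarrow> nat \<Rightarrow> 'a topology \<Rightarrow> ('a \<Rightarrow> 'a) set \<Rightarrow> (nat \<Rightarrow> 'a \<Rightarrow> 'a) \<Rightarrow> bool" where
  "standard_generators p n X H a \<longleftrightarrow>
     (let G = transformation_group X H in
       a ` {1..n + 1} \<subseteq> H \<and>
       (\<forall>j \<in> {1..n + 1}. group.ord G (a j) = p) \<and>
       (\<Otimes>\<^bsub>G\<^esub>j \<in> {1..n + 1}. a j) = \<one>\<^bsub>G\<^esub> \<and>
       generate G (a ` {1..n}) = H \<and>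
       (\<forall>h \<in> H. h \<noteq> \<one>\<^bsub>G\<^esub> \<and> has_fixed_point X h \<longrightarrow>
          (\<exists>j \<in> {1..n + 1}. \<exists>m::int. h = a j [^]\<^bsub>G\<^esub> m)) \<and>
       (\<forall>j \<in> {1..n + 1}. has_fixed_point X (a j)))"

text \<open>Here \<open>u 0, \<dots>, u (p ^ r - 1)\<close> lists the elements of \<open>Zpow p r\<close>, starting with the identity.\<close>

definition is_ordering :: "nat \<Rightarrow> nat \<Rightarrow> (nat \<Rightarrow> nat \<Rightarrow> int) \<Rightarrow> bool" where
  "is_ordering p r u \<longleftrightarrow>
     bij_betw u {0..p ^ r - 1} (carrier (Zpow p r)) \<and> u 0 = \<one>\<^bsub>Zpow p r\<^esub>"

text \<open>A tuple \<open>(I 1, \<dots>, I (p ^ r - 1))\<close> is a function that is extensional on the index set.\<close>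

definition partition_tuples ::
    "nat \<Rightarrow> nat \<Rightarrow> nat \<Rightarrow> (nat \<Rightarrow> nat \<Rightarrow> int) \<Rightarrow> (nat \<Rightarrow> nat set) set" where
  "partition_tuples p n r u =
     {I \<in> {1..p ^ r - 1} \<rightarrow>\<^sub>E Pow {1..n + 1}.
        disjoint_family_on I {1..p ^ r - 1} \<and>
        (\<Union>k \<in> {1..p ^ r - 1}. I k) = {1..n + 1} \<and>
        (\<Otimes>\<^bsub>Zpow p r\<^esub>k \<in> {1..p ^ r - 1}. u k [^]\<^bsub>Zpow p r\<^esub> card (I k)) = \<one>\<^bsub>Zpow p r\<^esub> \<and>
        generate (Zpow p r) (u ` {k \<in> {1..p ^ r - 1}. I k \<noteq> {}}) = carrier (Zpow p r)}"

definition admissible_ranks :: "nat \<Rightarrow> nat \<Rightarrow> (nat \<Rightarrow> nat \<Rightarrow> nat \<Rightarrow> int) \<Rightarrow> nat set" where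
  "admissible_ranks p n u = {r \<in> {1..n - 1}. partition_tuples p n r (u r) \<noteq> {}}"

text \<open>The surjection sending \<open>a j\<close> to \<open>u k\<close> for \<open>j \<in> I k\<close>. Extensionality makes the
  description unique when the \<open>a j\<close> generate \<open>H\<close>.\<close>

definition rho ::
    "nat \<Rightarrow> 'a topology \<Rightarrow> ('a \<Rightarrow> 'a) set \<Rightarrow> (nat \<Rightarrow> 'a \<Rightarrow> 'a) \<Rightarrow> nat \<Rightarrow> (nat \<Rightarrow> nat \<Rightarrow> int) \<Rightarrow>
     (nat \<Rightarrow> nat set) \<Rightarrow> ('a \<Rightarrow> 'a) \<Rightarrow> nat \<Rightarrow> int" where
  "rho p X H a r u I =
     (THE \<rho>. \<rho> \<in> extensional H \<and> \<rho> \<in> epi (transformation_group X H) (Zpow p r) \<and>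
        (\<forall>k \<in> {1..p ^ r - 1}. \<forall>j \<in> I k. \<rho> (a j) = u k))"

definition kernel_of_partition ::
    "nat \<Rightarrow> 'a topology \<Rightarrow> ('a \<Rightarrow> 'a) set \<Rightarrow> (nat \<Rightarrow> 'a \<Rightarrow> 'a) \<Rightarrow> nat \<Rightarrow> (nat \<Rightarrow> nat \<Rightarrow> int) \<Rightarrow>
     (nat \<Rightarrow> nat set) \<Rightarrow> ('a \<Rightarrow> 'a) set" where
  "kernel_of_partition p X H a r u I =
     kernel (transformation_group X H) (Zpow p r) (rho p X H a r u I)"

end

theory Submission
  imports Defs
begin

text \<open>The group \<open>H\<close> is an \<open>n\<close>-dimensional vector space over the field with \<open>p\<close> elements,
  with basis \<open>a 1, \<dots>, a n\<close>. Since every non-trivial element with a fixed point is a power of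
  some \<open>a j\<close>, and since a subgroup containing a non-trivial power of \<open>a j\<close> contains \<open>a j\<close>
  itself, \<open>K\<close> acts freely iff it contains none of the \<open>a j\<close>. Writing \<open>K\<close> as the kernel of an
  epimorphism \<open>f\<close> onto \<open>Zpow p r\<close>, this means that no \<open>f (a j)\<close> is trivial, so that the fibres
  of \<open>j \<mapsto> f (a j)\<close> form an admissible tuple. Conversely an admissible tuple prescribes
  non-trivial values on the \<open>a j\<close> that respect their only relation, and hence determines \<open>f\<close>.\<close>

section \<open>The model group \<open>Zpow p r\<close> in coordinates\<close>

lemma carrier_Zpow: "p > 0 \<Longrightarrow> carrier (Zpow p r) = ({..<r} \<rightarrow>\<^sub>E {0..<int p})"
  by (simp add: Zpow_def carrier_integer_mod_group)

lemma one_Zpow: "\<one>\<^bsub>Zpow p r\<^esub> = (\<lambda>i\<in>{..<r}. 0)"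
  by (simp add: Zpow_def)

lemma mult_Zpow: "x \<otimes>\<^bsub>Zpow p r\<^esub> y = (\<lambda>i\<in>{..<r}. (x i + y i) mod int p)"
  by (simp add: Zpow_def)

lemma comm_group_Zpow: "comm_group (Zpow p r)"
  by (rule group.group_comm_groupI) (simp_all add: Zpow_def add.commute)

lemma card_carrier_Zpow: "p > 0 \<Longrightarrow> card (carrier (Zpow p r)) = p ^ r"
  by (simp add: carrier_Zpow card_PiE)

lemma finite_carrier_Zpow: "p > 0 \<Longrightarrow> finite (carrier (Zpow p r))"
  by (simp add: carrier_Zpow finite_PiE)

lemma nat_pow_Zpow: "x [^]\<^bsub>Zpow p r\<^esub> (m::nat) = (\<lambda>i\<in>{..<r}. (int m * x i) mod int p)"
proof (induction m)
  case (Suc m)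
  then show ?case
    by (auto simp: mult_Zpow fun_eq_iff mod_add_right_eq distrib_right add.commute)
qed (simp add: one_Zpow)

section \<open>Elementary abelian groups as vector spaces over the field with \<open>p\<close>
  elements\<close>

locale elementary_abelian_group = comm_group G for G (structure) +
  fixes p :: nat
  assumes prime_p: "prime p"
    and exponent: "x \<in> carrier G \<Longrightarrow> x [^] p = \<one>"

lemma elementary_abelian_Zpow:
  assumes "prime p"
  shows "elementary_abelian_group (Zpow p r) p"
proof (intro elementary_abelian_group.intro comm_group_Zpow elementary_abelian_group_axioms.intro assms)
  show "x [^]\<^bsub>Zpow p r\<^esub> p = \<one>\<^bsub>Zpow p r\<^esub>" for x
    by (simp add: nat_pow_Zpow one_Zpow)
qed

text \<open>Commutativity and the exponent pass along a surjective homomorphism. Applied to an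
  isomorphism from \<open>Zpow p n\<close> this covers \<open>H\<close>; applied to the canonical
  projection it covers the quotients of \<open>H\<close>.\<close>

lemma elementary_abelian_hom_image:
  assumes "elementary_abelian_group G p" "group G'" "f \<in> hom G G'" "f ` carrier G = carrier G'"
  shows "elementary_abelian_group G' p"
proof -
  interpret elementary_abelian_group G p by fact
  interpret G': group G' by fact
  interpret group_hom G G' f
    by unfold_locales (use assms in auto)
  show ?thesis
  proof (intro elementary_abelian_group.intro elementary_abelian_group_axioms.intro prime_p)
    show "comm_group G'"
    proof (rule G'.group_comm_groupI)
      fix x y assume "x \<in> carrier G'" "y \<in> carrier G'"
      then obtain s t where "s \<in> carrier G" "x = f s" "t \<in> carrier G" "y = f t"
        using assms(4) by blast
      then show "x \<otimes>\<^bsub>G'\<^esub> y = y \<otimes>\<^bsub>G'\<^esub> x"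
        by (metis hom_mult m_comm)
    qed
    fix x assume "x \<in> carrier G'"
    then obtain s where "s \<in> carrier G" "x = f s"
      using assms(4) by blast
    then show "x [^]\<^bsub>G'\<^esub> p = \<one>\<^bsub>G'\<^esub>"
      by (metis exponent hom_nat_pow hom_one)
  qed
qed

text \<open>Additively, the linear combination of the family \<open>b\<close> with coefficients
  \<open>c\<close>. Over an elementary abelian group, as a map out of \<open>Zpow p r\<close>, it is
  injective iff \<open>b\<close> is linearly independent and surjective iff \<open>b\<close>
  spans.\<close>

definition power_product :: "('b, 'c) monoid_scheme \<Rightarrow> nat \<Rightarrow> (nat \<Rightarrow> 'b) \<Rightarrow> (nat \<Rightarrow> int) \<Rightarrow> 'b" where
  "power_product G r b c = (\<Otimes>\<^bsub>G\<^esub>i\<in>{..<r}. b i [^]\<^bsub>G\<^esub> c i)"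

context elementary_abelian_group
begin

lemma p_gt_1: "p > 1"
  using prime_p by (rule prime_gt_1_nat)

text \<open>The order of \<open>x\<close> divides \<open>p\<close>, and \<open>p\<close> divides
  \<open>k - k mod int p\<close>. This makes integer powers compatible with the reduction modulo
  \<open>p\<close> in \<open>Zpow\<close>.\<close>

lemma int_pow_mod: "x \<in> carrier G \<Longrightarrow> x [^] (k mod int p) = x [^] k"
proof -
  assume x: "x \<in> carrier G"
  then have "int (ord x) dvd int p"
    using exponent by (simp add: pow_eq_id)
  also have "int p dvd k - k mod int p"
    by (rule dvd_minus_mod)
  finally show ?thesis
    using x by (simp add: int_pow_eq)
qed

lemma power_product_hom:
  assumes "b \<in> {..<r} \<rightarrow> carrier G"
  shows "power_product G r b \<in> hom (Zpow p r) G"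
proof (rule homI)
  show "power_product G r b c \<in> carrier G" for c
    unfolding power_product_def using assms by (intro finprod_closed) auto
  fix c d :: "nat \<Rightarrow> int"
  have "power_product G r b (c \<otimes>\<^bsub>Zpow p r\<^esub> d) = (\<Otimes>i\<in>{..<r}. b i [^] c i \<otimes> b i [^] d i)"
    unfolding power_product_def
    by (rule finprod_cong') (use assms in \<open>auto simp: mult_Zpow int_pow_mod int_pow_mult Pi_iff\<close>)
  also have "\<dots> = power_product G r b c \<otimes> power_product G r b d"
    unfolding power_product_def by (rule finprod_multf) (use assms in auto)
  finally show "power_product G r b (c \<otimes>\<^bsub>Zpow p r\<^esub> d) = power_product G r b c \<otimes> power_product G r b d" .
qed

lemma power_product_group_hom:
  assumes "b \<in> {..<r} \<rightarrow> carrier G"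
  shows "group_hom (Zpow p r) G (power_product G r b)"
  using comm_group.axioms(2) [OF comm_group_Zpow [of p r]] power_product_hom [OF assms]
  by (simp add: group_hom_def group_hom_axioms_def)

lemma unit_vector_Zpow: "(\<lambda>j\<in>{..<r}. if j = i then 1 else 0) \<in> carrier (Zpow p r)"
  using p_gt_1 by (auto simp: carrier_Zpow)

lemma power_product_unit_vector:
  assumes "b \<in> {..<r} \<rightarrow> carrier G" "i < r"
  shows "power_product G r b (\<lambda>j\<in>{..<r}. if j = i then 1 else 0) = b i"
proof -
  have "power_product G r b (\<lambda>j\<in>{..<r}. if j = i then 1 else 0) = (\<Otimes>j\<in>{..<r}. if j = i then b j else \<one>)"
    unfolding power_product_def by (rule finprod_cong') (use assms in \<open>auto simp: Pi_iff\<close>)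
  also have "\<dots> = b i"
    using assms by (intro finprod_singleton_swap) auto
  finally show ?thesis .
qed

text \<open>The image is a subgroup, and unit vectors show that it contains every
  \<open>b i\<close>.\<close>

lemma power_product_surj:
  assumes "b \<in> {..<r} \<rightarrow> carrier G" "generate G (b ` {..<r}) = carrier G"
  shows "power_product G r b ` carrier (Zpow p r) = carrier G"
proof
  interpret gh: group_hom "Zpow p r" G "power_product G r b"
    using assms(1) by (rule power_product_group_hom)
  have "b ` {..<r} \<subseteq> power_product G r b ` carrier (Zpow p r)"
    using power_product_unit_vector [OF assms(1)] unit_vector_Zpow
    by (metis (no_types, lifting) image_subset_iff imageI lessThan_iff)
  then have "generate G (b ` {..<r}) \<subseteq> power_product G r b ` carrier (Zpow p r)"
    using gh.img_is_subgroup by (rule generate_subgroup_incl)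
  then show "carrier G \<subseteq> power_product G r b ` carrier (Zpow p r)"
    using assms(2) by simp
qed (use power_product_hom [OF assms(1)] in \<open>auto simp: hom_def\<close>)

lemma power_product_Suc:
  assumes "b \<in> {..<r} \<rightarrow> carrier G" "g \<in> carrier G"
  shows "power_product G (Suc r) (b(r := g)) c = g [^] c r \<otimes> power_product G r b (restrict c {..<r})"
proof -
  have "power_product G (Suc r) (b(r := g)) c = g [^] c r \<otimes> (\<Otimes>i\<in>{..<r}. (b(r := g)) i [^] c i)"
    unfolding power_product_def lessThan_Suc by (subst finprod_insert) (use assms in \<open>auto simp: Pi_iff\<close>)
  also have "(\<Otimes>i\<in>{..<r}. (b(r := g)) i [^] c i) = power_product G r b (restrict c {..<r})"
    unfolding power_product_def by (rule finprod_cong') (use assms in auto)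
  finally show ?thesis .
qed

text \<open>Bezout makes \<open>k\<close> invertible modulo \<open>p\<close>, and raising
  \<open>g [^] k\<close> to the inverse exponent recovers \<open>g\<close>. This serves twice: for
  linear independence, and to pass from a power of \<open>a j\<close> in \<open>K\<close> to
  \<open>a j\<close> itself.\<close>

lemma subgroup_int_pow_cancel:
  assumes "subgroup N G" "g \<in> carrier G" "g [^] (k::int) \<in> N" "0 < k" "k < int p"
  shows "g \<in> N"
proof -
  have "\<not> int p dvd k"
    using assms(4,5) by (meson zdvd_not_zless)
  then have "coprime (int p) k"
    using prime_p by (simp add: prime_imp_coprime)
  then obtain s t where st: "s * int p + t * k = 1"
    using bezout_int [of "int p" k] by (auto simp: coprime_iff_gcd_eq_1)
  have "(k * t) mod int p = 1 mod int p"
    using arg_cong [OF st, of "\<lambda>z. z mod int p"] by (simp add: mult.commute)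
  then have "g [^] (k * t) = g [^] (1::int)"
    using int_pow_mod [OF assms(2)] by metis
  then have "(g [^] k) [^] t = g"
    using assms(2) by (simp add: int_pow_pow)
  then show ?thesis
    using assms(1,3) by (metis subgroup_int_pow_closed)
qed

text \<open>In a relation with non-zero last coefficient, a power of \<open>g\<close> would lie in
  the span of \<open>b\<close>, hence so would \<open>g\<close>. So the last coefficient vanishes,
  and independence of \<open>b\<close> kills the others.\<close>

lemma power_product_inj_extend:
  assumes b: "b \<in> {..<r} \<rightarrow> carrier G" and inj: "inj_on (power_product G r b) (carrier (Zpow p r))"
    and g: "g \<in> carrier G" "g \<notin> power_product G r b ` carrier (Zpow p r)"
  shows "inj_on (power_product G (Suc r) (b(r := g))) (carrier (Zpow p (Suc r)))"
proof -
  let ?\<Phi> = "power_product G r b"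
  interpret gh: group_hom "Zpow p r" G ?\<Phi>
    using b by (rule power_product_group_hom)
  have b': "b(r := g) \<in> {..<Suc r} \<rightarrow> carrier G"
    using b g by (auto simp: Pi_iff less_Suc_eq)
  interpret gh': group_hom "Zpow p (Suc r)" G "power_product G (Suc r) (b(r := g))"
    using b' by (rule power_product_group_hom)
  have p0: "p > 0"
    using p_gt_1 by simp
  have "c = \<one>\<^bsub>Zpow p (Suc r)\<^esub>"
    if c: "c \<in> carrier (Zpow p (Suc r))" and 1: "power_product G (Suc r) (b(r := g)) c = \<one>" for c
  proof -
    have c': "restrict c {..<r} \<in> carrier (Zpow p r)" and cr: "0 \<le> c r" "c r < int p"
      using c p0 by (auto simp: carrier_Zpow PiE_iff)
    have eq: "g [^] c r \<otimes> ?\<Phi> (restrict c {..<r}) = \<one>"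
      using 1 power_product_Suc [OF b g(1)] by simp
    have "g [^] c r = inv (?\<Phi> (restrict c {..<r}))"
      using eq c' g by (metis gh.hom_closed int_pow_closed inv_equality)
    then have "g [^] c r \<in> ?\<Phi> ` carrier (Zpow p r)"
      using c' gh.img_is_subgroup by (simp add: subgroup.m_inv_closed)
    then have "c r = 0"
      using subgroup_int_pow_cancel [OF gh.img_is_subgroup g(1)] g(2) cr by force
    then have "?\<Phi> (restrict c {..<r}) = \<one>"
      using eq c' gh.hom_closed by simp
    then have "restrict c {..<r} = \<one>\<^bsub>Zpow p r\<^esub>"
      using inj c' gh.hom_one gh.G.one_closed by (metis inj_onD)
    then have "c i = 0" if "i < Suc r" for i
      using \<open>c r = 0\<close> that by (metis lessThan_iff less_Suc_eq one_Zpow restrict_apply')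
    then show ?thesis
      using c p0 by (auto simp: carrier_Zpow one_Zpow PiE_iff extensional_def)
  qed
  then show ?thesis
    by (simp add: gh'.inj_on_one_iff)
qed

text \<open>A family that is independent and of maximal length is a basis.\<close>

lemma iso_Zpow:
  assumes "finite (carrier G)"
  obtains r where "Zpow p r \<cong> G"
proof -
  \<comment> \<open>\<open>R r\<close> says that some family of length \<open>r\<close> is
    independent.\<close>
  define R where "R = (\<lambda>r. \<exists>b \<in> {..<r} \<rightarrow> carrier G. inj_on (power_product G r b) (carrier (Zpow p r)))"
  \<comment> \<open>Injectivity embeds \<open>p ^ r\<close> elements into \<open>G\<close>, and
    \<open>r < 2 ^ r \<le> p ^ r\<close>. This bound ensures that a greatest such \<open>r\<close>
    exists.\<close>
  have bound: "r \<le> card (carrier G)" if "R r" for r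
  proof -
    obtain b where b: "b \<in> {..<r} \<rightarrow> carrier G"
      and inj: "inj_on (power_product G r b) (carrier (Zpow p r))"
      using \<open>R r\<close> R_def by blast
    have "power_product G r b ` carrier (Zpow p r) \<subseteq> carrier G"
      using power_product_hom [OF b] by (auto simp: hom_def)
    then have "p ^ r \<le> card (carrier G)"
      using card_inj_on_le [OF inj _ assms] p_gt_1 by (simp add: card_carrier_Zpow)
    then show ?thesis
      using less_exp [of r] power_mono [of 2 p r] p_gt_1 by linarith
  qed
  \<comment> \<open>\<open>Zpow p 0\<close> has a single element, so the empty family is
    independent.\<close>
  have "R 0"
    using p_gt_1 by (auto simp: R_def carrier_Zpow)
  define r where "r = Greatest R"
  have "R r" and max: "\<not> R (Suc r)"
    unfolding r_def using GreatestI_nat [of R, OF \<open>R 0\<close>] Greatest_le_nat [of R] bound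
    by (blast, metis not_less_eq_eq order_refl)
  then obtain b where b: "b \<in> {..<r} \<rightarrow> carrier G"
    and inj: "inj_on (power_product G r b) (carrier (Zpow p r))"
    using R_def by blast
  \<comment> \<open>An element outside the span would extend \<open>b\<close> to an independent
    family of length \<open>Suc r\<close>.\<close>
  have "g \<in> power_product G r b ` carrier (Zpow p r)" if "g \<in> carrier G" for g
  proof (rule ccontr)
    assume "g \<notin> power_product G r b ` carrier (Zpow p r)"
    then have "inj_on (power_product G (Suc r) (b(r := g))) (carrier (Zpow p (Suc r)))"
      using power_product_inj_extend [OF b inj] that by blast
    moreover have "b(r := g) \<in> {..<Suc r} \<rightarrow> carrier G"
      using b that by (auto simp: Pi_iff less_Suc_eq)
    ultimately show False
      using max R_def by blast
  qed
  then have "power_product G r b \<in> iso (Zpow p r) G"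
    using power_product_hom [OF b] inj by (auto simp: iso_def bij_betw_def hom_def)
  then show thesis
    using that is_isoI by blast
qed

text \<open>By counting, \<open>n\<close> generators of a group of order \<open>p ^ n\<close> form a
  basis: the surjection \<open>power_product G n b\<close> between finite sets of equal size is
  injective. Hence values on them can be prescribed freely.\<close>

lemma hom_extension:
  assumes b: "b \<in> {..<n} \<rightarrow> carrier G" "generate G (b ` {..<n}) = carrier G"
    and card: "card (carrier G) = p ^ n"
    and G': "elementary_abelian_group G' p" and d: "d \<in> {..<n} \<rightarrow> carrier G'"
  obtains f where "f \<in> hom G G'" "\<And>i. i < n \<Longrightarrow> f (b i) = d i"
proof -
  interpret G': elementary_abelian_group G' p by fact
  let ?\<Phi> = "power_product G n b"
  interpret gh: group_hom "Zpow p n" G ?\<Phi>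
    using b(1) by (rule power_product_group_hom)
  have surj: "?\<Phi> ` carrier (Zpow p n) = carrier G"
    using b by (rule power_product_surj)
  have inj: "inj_on ?\<Phi> (carrier (Zpow p n))"
    using p_gt_1 card surj by (simp add: eq_card_imp_inj_on finite_carrier_Zpow card_carrier_Zpow)
  \<comment> \<open>Read off the coordinates with respect to \<open>b\<close>, then recombine them
    with \<open>d\<close>.\<close>
  define f where "f = power_product G' n d \<circ> inv_into (carrier (Zpow p n)) ?\<Phi>"
  have "inv_into (carrier (Zpow p n)) ?\<Phi> \<in> hom G (Zpow p n)"
    using gh.G.iso_set_sym [of ?\<Phi> G] inj surj gh.homh by (simp add: iso_def bij_betw_def)
  then have "f \<in> hom G G'"
    unfolding f_def using G'.power_product_hom [OF d] by (rule Group.hom_compose)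
  moreover have "f (b i) = d i" if "i < n" for i
    using power_product_unit_vector [OF b(1) that] G'.power_product_unit_vector [OF d that]
      inv_into_f_f [OF inj unit_vector_Zpow [of i n]]
    by (simp add: f_def)
  ultimately show thesis
    using that by blast
qed

end

section \<open>Homomorphisms prescribed on generators, and products over partitions\<close>

lemma (in group_hom) hom_eq_on_generate:
  assumes "g \<in> hom G H" "A \<subseteq> carrier G" "\<And>x. x \<in> A \<Longrightarrow> h x = g x" "x \<in> generate G A"
  shows "h x = g x"
proof -
  interpret g: group_hom G H g
    using assms(1) by unfold_locales
  show ?thesis
    using assms(4)
  proof induction
    case (inv y)
    then show ?case
      using assms(2,3) by (metis g.hom_inv hom_inv subsetD)
  next
    case (eng y z)
    then show ?case
      using assms(2) by (metis G.generate_in_carrier g.hom_mult hom_mult)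
  qed (use assms(3) in auto)
qed

lemma (in group_hom) hom_finprod:
  assumes "comm_group G" "comm_group H" "b \<in> A \<rightarrow> carrier G"
  shows "h (\<Otimes>\<^bsub>G\<^esub>i\<in>A. b i) = (\<Otimes>\<^bsub>H\<^esub>i\<in>A. h (b i))"
proof -
  interpret G: comm_group G by fact
  interpret H: comm_group H by fact
  show ?thesis
    using assms(3)
  \<comment> \<open>For infinite \<open>A\<close> both products default to the identity.\<close>
  proof (induction A rule: infinite_finite_induct)
    case (insert i A)
    then have "(\<lambda>i. h (b i)) \<in> A \<rightarrow> carrier H"
      by (auto simp: Pi_iff)
    then show ?case
      using insert by (simp add: Pi_iff)
  qed auto
qed

text \<open>Group the factors by the disjoint parts. This translates between the product condition
  on a tuple and the relation among the images of the \<open>a j\<close>, and is used in both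
  directions.\<close>

lemma (in comm_group) finprod_constant_on_parts:
  assumes J: "finite J" "disjoint_family_on P J" "finite A" and UN: "(\<Union>k\<in>J. P k) = A"
    and u: "u ` J \<subseteq> carrier G" and d: "\<And>k j. k \<in> J \<Longrightarrow> j \<in> P k \<Longrightarrow> d j = u k"
  shows "(\<Otimes>j\<in>A. d j) = (\<Otimes>k\<in>J. u k [^] card (P k))"
proof -
  have "finite (P k)" if "k \<in> J" for k
    using J(3) UN that by (metis UN_upper finite_subset)
  then have "(\<Otimes>j\<in>A. d j) = (\<Otimes>k\<in>J. \<Otimes>j\<in>P k. d j)"
    unfolding UN [symmetric] using J u d by (intro finprod_UN_disjoint) (auto simp: disjoint_family_on_def pairwise_def disjnt_def)
  also have "(\<Otimes>k\<in>J. \<Otimes>j\<in>P k. d j) = (\<Otimes>k\<in>J. u k [^] card (P k))"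
  proof (rule finprod_cong')
    fix k assume k: "k \<in> J"
    have "(\<Otimes>j\<in>P k. d j) = (\<Otimes>j\<in>P k. u k)"
      using u d k by (intro finprod_cong') auto
    then show "(\<Otimes>j\<in>P k. d j) = u k [^] card (P k)"
      using u k by (simp add: finprod_const image_subset_iff)
  qed (use u in auto)
  finally show ?thesis .
qed

text \<open>Matches the generation condition on a tuple, which sees only non-empty parts, with
  generation by the images of the \<open>a j\<close>.\<close>

lemma image_constant_on_parts:
  assumes "(\<Union>k\<in>J. P k) = A" and "\<And>k j. k \<in> J \<Longrightarrow> j \<in> P k \<Longrightarrow> d j = u k"
  shows "u ` {k \<in> J. P k \<noteq> {}} = d ` A"
proof (intro equalityI subsetI)
  fix y assume "y \<in> u ` {k \<in> J. P k \<noteq> {}}"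
  then obtain k j where "k \<in> J" "j \<in> P k" "y = u k"
    by blast
  moreover have "j \<in> A"
    using assms(1) calculation by blast
  ultimately show "y \<in> d ` A"
    using assms(2) by (metis imageI)
next
  fix y assume "y \<in> d ` A"
  then obtain k j where k: "k \<in> J" "j \<in> P k" "y = d j"
    using assms(1) by blast
  then have "y = u k"
    using assms(2) by simp
  then show "y \<in> u ` {k \<in> J. P k \<noteq> {}}"
    using k by blast
qed

text \<open>The elements \<open>a 1, ..., a n\<close> form a basis, so \<open>f\<close> can be
  prescribed there; the value at \<open>a (n + 1)\<close> is then forced by the relation, which
  \<open>d\<close> satisfies as well.\<close>

lemma (in elementary_abelian_group) hom_extension_relation:
  fixes a :: "nat \<Rightarrow> 'a"
  assumes a: "a ` {1..n + 1} \<subseteq> carrier G" "(\<Otimes>j\<in>{1..n + 1}. a j) = \<one>"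
    and gen: "generate G (a ` {1..n}) = carrier G" and card: "card (carrier G) = p ^ n"
    and G': "elementary_abelian_group G' p"
    and d: "d ` {1..n + 1} \<subseteq> carrier G'" "(\<Otimes>\<^bsub>G'\<^esub>j\<in>{1..n + 1}. d j) = \<one>\<^bsub>G'\<^esub>"
  obtains f where "f \<in> hom G G'" "\<And>j. j \<in> {1..n + 1} \<Longrightarrow> f (a j) = d j"
proof -
  interpret G': elementary_abelian_group G' p by fact
  \<comment> \<open>Bases are indexed from 0, the standard generators from 1.\<close>
  have shift: "(\<lambda>i. a (Suc i)) ` {..<n} = a ` {1..n}"
    by (metis One_nat_def image_Suc_lessThan image_image)
  obtain f where f: "f \<in> hom G G'" and fa: "\<And>i. i < n \<Longrightarrow> f (a (Suc i)) = d (Suc i)"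
  proof (rule hom_extension [of "\<lambda>i. a (Suc i)" n G' "\<lambda>i. d (Suc i)"])
    show "generate G ((\<lambda>i. a (Suc i)) ` {..<n}) = carrier G"
      using gen shift by simp
  qed (use a d card G' in \<open>auto simp: image_subset_iff\<close>)
  interpret group_hom G G' f
    using f by unfold_locales
  have eq: "f (a j) = d j" if "j \<in> {1..n}" for j
    using fa [of "j - 1"] that by (cases j) auto
  have split: "{1..n + 1} = insert (n + 1) {1..n}"
    by auto
  have "a (n + 1) \<otimes> (\<Otimes>j\<in>{1..n}. a j) = \<one>"
    using a unfolding split by (subst (asm) finprod_insert) auto
  moreover have "f (\<Otimes>j\<in>{1..n}. a j) = (\<Otimes>\<^bsub>G'\<^esub>j\<in>{1..n}. d j)"
  proof -
    have "f (\<Otimes>j\<in>{1..n}. a j) = (\<Otimes>\<^bsub>G'\<^esub>j\<in>{1..n}. f (a j))"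
      using a by (intro hom_finprod comm_group_axioms G'.comm_group_axioms) (auto simp: image_subset_iff)
    also have "\<dots> = (\<Otimes>\<^bsub>G'\<^esub>j\<in>{1..n}. d j)"
      using d eq by (intro G'.finprod_cong') (auto simp: image_subset_iff)
    finally show ?thesis .
  qed
  moreover have "a (n + 1) \<in> carrier G" "(\<Otimes>j\<in>{1..n}. a j) \<in> carrier G"
    using a by (auto intro!: finprod_closed simp: image_subset_iff)
  ultimately have "f (a (n + 1)) \<otimes>\<^bsub>G'\<^esub> (\<Otimes>\<^bsub>G'\<^esub>j\<in>{1..n}. d j) = \<one>\<^bsub>G'\<^esub>"
    by (metis hom_mult hom_one)
  moreover have "d (n + 1) \<otimes>\<^bsub>G'\<^esub> (\<Otimes>\<^bsub>G'\<^esub>j\<in>{1..n}. d j) = \<one>\<^bsub>G'\<^esub>"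
    using d unfolding split by (subst (asm) G'.finprod_insert) auto
  moreover have "(\<Otimes>\<^bsub>G'\<^esub>j\<in>{1..n}. d j) \<in> carrier G'" "d (n + 1) \<in> carrier G'"
    using d by (auto intro!: G'.finprod_closed simp: image_subset_iff)
  \<comment> \<open>Both sides are inverse to the same product over \<open>{1..n}\<close>.\<close>
  ultimately have "f (a (n + 1)) = d (n + 1)"
    using \<open>a (n + 1) \<in> carrier G\<close> by (metis G'.right_cancel hom_closed)
  then have "f (a j) = d j" if "j \<in> {1..n + 1}" for j
    using eq that unfolding split by blast
  then show thesis
    using that f by blast
qed

section \<open>Admissible tuples, their epimorphisms, and subgroups as kernels\<close>

lemma is_ordering_closed: "is_ordering p r u \<Longrightarrow> k \<in> {0..p ^ r - 1} \<Longrightarrow> u k \<in> carrier (Zpow p r)"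
  unfolding is_ordering_def by (metis bij_betwE)

text \<open>The source of freeness: tuples have no slot for index 0, which by injectivity is the
  only one carrying the identity, so no generator is sent to the identity.\<close>

lemma is_ordering_neq_one: "is_ordering p r u \<Longrightarrow> k \<in> {1..p ^ r - 1} \<Longrightarrow> u k \<noteq> \<one>\<^bsub>Zpow p r\<^esub>"
  unfolding is_ordering_def bij_betw_def
  by (metis atLeastAtMost_iff inj_onD le0 le_trans not_one_le_zero)

lemma partition_tuples_cover:
  assumes "P \<in> partition_tuples p n r u" "j \<in> {1..n + 1}"
  obtains k where "k \<in> {1..p ^ r - 1}" "j \<in> P k"
proof -
  have "j \<in> (\<Union>k\<in>{1..p ^ r - 1}. P k)"
    using assms by (simp add: partition_tuples_def)
  then show thesis
    using that by (rule UN_E)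
qed

text \<open>Justifies the definite description in \<open>rho\<close>. Existence comes from extending
  values that respect the relation, uniqueness from \<open>a 1, ..., a n\<close> generating
  \<open>G\<close>.\<close>

lemma (in elementary_abelian_group) ex1_epi_partition:
  fixes a :: "nat \<Rightarrow> 'a"
  assumes a: "a ` {1..n + 1} \<subseteq> carrier G" "(\<Otimes>j\<in>{1..n + 1}. a j) = \<one>"
    and gen: "generate G (a ` {1..n}) = carrier G" and card: "card (carrier G) = p ^ n"
    and u: "is_ordering p r u" and P: "P \<in> partition_tuples p n r u"
  shows "\<exists>!f. f \<in> extensional (carrier G) \<and> f \<in> epi G (Zpow p r) \<and>
           (\<forall>k \<in> {1..p ^ r - 1}. \<forall>j \<in> P k. f (a j) = u k)"
proof (rule ex_ex1I)
  let ?Z = "Zpow p r" and ?J = "{1..p ^ r - 1}"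
  interpret Z: elementary_abelian_group ?Z p
    using prime_p by (rule elementary_abelian_Zpow)
  have disj: "disjoint_family_on P ?J" and UN: "(\<Union>k\<in>?J. P k) = {1..n + 1}"
    and rel: "(\<Otimes>\<^bsub>?Z\<^esub>k\<in>?J. u k [^]\<^bsub>?Z\<^esub> card (P k)) = \<one>\<^bsub>?Z\<^esub>"
    and genP: "generate ?Z (u ` {k \<in> ?J. P k \<noteq> {}}) = carrier ?Z"
    using P by (auto simp: partition_tuples_def)
  have uJ: "u ` ?J \<subseteq> carrier ?Z"
    using is_ordering_closed [OF u] by auto
  \<comment> \<open>The value attached to the part containing \<open>j\<close>; disjointness makes
    the description unique for every covered \<open>j\<close>.\<close>
  define d where "d j = u (THE k. k \<in> ?J \<and> j \<in> P k)" for j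
  have dP: "d j = u k" if "k \<in> ?J" "j \<in> P k" for k j
  proof -
    have "(THE k. k \<in> ?J \<and> j \<in> P k) = k"
      using that disj unfolding disjoint_family_on_def by (intro the_equality) blast+
    then show ?thesis
      by (simp add: d_def)
  qed
  have d: "d ` {1..n + 1} \<subseteq> carrier ?Z"
    unfolding UN [symmetric] using dP uJ by auto
  have "(\<Otimes>\<^bsub>?Z\<^esub>j\<in>{1..n + 1}. d j) = \<one>\<^bsub>?Z\<^esub>"
    using Z.finprod_constant_on_parts [OF _ disj _ UN uJ dP] rel by simp
  then obtain f where f: "f \<in> hom G ?Z" and fa: "\<And>j. j \<in> {1..n + 1} \<Longrightarrow> f (a j) = d j"
    using hom_extension_relation [OF a gen card Z.elementary_abelian_group_axioms d] by metis
  interpret f: group_hom G ?Z f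
    using f by unfold_locales
  have faP: "f (a j) = u k" if "k \<in> ?J" "j \<in> P k" for k j
  proof -
    have "j \<in> {1..n + 1}"
      using that UN by blast
    then show ?thesis
      using fa dP [OF that] by simp
  qed
  \<comment> \<open>Surjectivity: the image of \<open>f\<close> is a subgroup containing the
    \<open>u k\<close> of all non-empty parts, and these generate \<open>Zpow p r\<close>.\<close>
  have "u ` {k \<in> ?J. P k \<noteq> {}} \<subseteq> f ` carrier G"
  proof -
    have "u ` {k \<in> ?J. P k \<noteq> {}} = (\<lambda>j. f (a j)) ` {1..n + 1}"
      by (rule image_constant_on_parts [OF UN faP])
    then show ?thesis
      using a(1) by auto
  qed
  then have "generate ?Z (u ` {k \<in> ?J. P k \<noteq> {}}) \<subseteq> f ` carrier G"
    using f.img_is_subgroup by (rule Z.generate_subgroup_incl)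
  then have "carrier ?Z \<subseteq> f ` carrier G"
    unfolding genP .
  then have "f ` carrier G = carrier ?Z"
    using f by (auto simp: hom_def)
  \<comment> \<open>Restriction supplies the required extensionality without changing values on
    \<open>G\<close>.\<close>
  moreover have "restrict f (carrier G) \<in> hom G ?Z"
    using f by (auto simp: hom_def)
  ultimately have "restrict f (carrier G) \<in> epi G ?Z"
    by (simp add: epi_def)
  moreover have "restrict f (carrier G) (a j) = u k" if "k \<in> ?J" "j \<in> P k" for k j
    using that faP UN a by (metis UN_I image_subset_iff restrict_apply')
  ultimately show "\<exists>f. f \<in> extensional (carrier G) \<and> f \<in> epi G ?Z \<and> (\<forall>k\<in>?J. \<forall>j\<in>P k. f (a j) = u k)"
    by (metis restrict_extensional)
  fix f g
  assume f: "f \<in> extensional (carrier G) \<and> f \<in> epi G ?Z \<and> (\<forall>k\<in>?J. \<forall>j\<in>P k. f (a j) = u k)"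
    and g: "g \<in> extensional (carrier G) \<and> g \<in> epi G ?Z \<and> (\<forall>k\<in>?J. \<forall>j\<in>P k. g (a j) = u k)"
  interpret f: group_hom G ?Z f
    using f by unfold_locales (simp add: epi_def)
  \<comment> \<open>Every index lies in some part, so both maps take the same prescribed value
    there.\<close>
  have eq: "f x = g x" if xa: "x \<in> a ` {1..n}" for x
  proof -
    obtain j where x: "x = a j" and "j \<in> {1..n}"
      using xa by blast
    then have "j \<in> {1..n + 1}"
      by simp
    with P obtain k where "k \<in> ?J" "j \<in> P k"
      by (rule partition_tuples_cover)
    then have "f (a j) = u k" "g (a j) = u k"
      using f g by simp_all
    then show ?thesis
      by (simp add: x)
  qed
  have "a ` {1..n} \<subseteq> carrier G"
    using a by auto
  then have "f x = g x" if "x \<in> carrier G" for x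
    using f.hom_eq_on_generate [of g "a ` {1..n}" x] eq g gen that by (simp add: epi_def)
  then show "f = g"
    using f g by (intro extensionalityI [of f "carrier G" g]) auto
qed

text \<open>The quotient by \<open>N\<close> is elementary abelian, hence isomorphic to some
  \<open>Zpow p r\<close>; compose the projection with such an isomorphism. The equation of orders
  is Lagrange's theorem and later bounds \<open>r\<close>.\<close>

lemma (in elementary_abelian_group) subgroup_eq_kernel:
  assumes "finite (carrier G)" "subgroup N G"
  obtains r f where "f \<in> extensional (carrier G)" "f \<in> epi G (Zpow p r)"
    "kernel G (Zpow p r) f = N" "p ^ r * card N = card (carrier G)"
proof -
  have "N \<lhd> G"
    using assms(2) by (simp add: normal_iff_subgroup)
  then interpret N: normal N G .
  interpret Q: elementary_abelian_group "G Mod N" p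
    by (rule elementary_abelian_hom_image [OF elementary_abelian_group_axioms N.factorgroup_is_group N.r_coset_hom_Mod])
      (simp add: carrier_FactGroup)
  have "finite (carrier (G Mod N))"
    using assms(1) by (simp add: carrier_FactGroup)
  then obtain r where r: "Zpow p r \<cong> G Mod N"
    using Q.iso_Zpow by blast
  interpret Z: comm_group "Zpow p r"
    by (rule comm_group_Zpow)
  obtain h where h: "h \<in> iso (G Mod N) (Zpow p r)"
    using Z.iso_sym [OF r] by (auto simp: is_iso_def)
  then interpret h: group_hom "G Mod N" "Zpow p r" h
    by unfold_locales (simp add: iso_def)
  define f where "f = restrict (\<lambda>x. h (N #> x)) (carrier G)"
  have closed: "N #> x \<in> carrier (G Mod N)" if "x \<in> carrier G" for x
    using that by (simp add: carrier_FactGroup)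
  have "f \<in> hom G (Zpow p r)"
  proof (rule homI)
    fix x y assume xy: "x \<in> carrier G" "y \<in> carrier G"
    then have "N #> (x \<otimes> y) = (N #> x) \<otimes>\<^bsub>G Mod N\<^esub> (N #> y)"
      using hom_mult [OF N.r_coset_hom_Mod] by blast
    then show "f (x \<otimes> y) = f x \<otimes>\<^bsub>Zpow p r\<^esub> f y"
      using xy closed by (simp add: f_def h.hom_mult del: mult_FactGroup)
  qed (use closed in \<open>simp add: f_def\<close>)
  moreover have "f ` carrier G = carrier (Zpow p r)"
  proof -
    have "f ` carrier G = h ` carrier (G Mod N)"
      by (auto simp: f_def carrier_FactGroup image_image)
    then show ?thesis
      using h by (simp add: iso_def bij_betw_def)
  qed
  ultimately have "f \<in> epi G (Zpow p r)"
    by (simp add: epi_def)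
  moreover have "kernel G (Zpow p r) f = N"
  proof -
    have "f x = \<one>\<^bsub>Zpow p r\<^esub> \<longleftrightarrow> x \<in> N" if x: "x \<in> carrier G" for x
    proof -
      have "f x = \<one>\<^bsub>Zpow p r\<^esub> \<longleftrightarrow> N #> x = N"
        using h x closed by (metis f_def h.hom_one h.iso_iff one_FactGroup restrict_apply')
      then show ?thesis
        using x assms(2) by (metis coset_join1 coset_join2)
    qed
    then show ?thesis
      using N.subset by (auto simp: kernel_def)
  qed
  moreover have "p ^ r * card N = card (carrier G)"
    using iso_same_card [OF r] lagrange [OF assms(2)] p_gt_1
    by (simp add: card_carrier_Zpow FactGroup_def order_def)
  ultimately show thesis
    using that by (metis f_def restrict_extensional)
qed

section \<open>Freely acting subgroups of \<open>H\<close> and kernels of admissible tuples\<close>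

theorem proposition4:
  fixes p n :: nat
    and X :: "'a topology" and \<A> :: "'a chart set"
    and H K :: "('a \<Rightarrow> 'a) set"
    and a :: "nat \<Rightarrow> 'a \<Rightarrow> 'a"
    and u :: "nat \<Rightarrow> nat \<Rightarrow> nat \<Rightarrow> int"
  assumes "prime p" and "n \<ge> 2" and "(p - 1) * (n - 1) > 2"
    and "generalized_Fermat_pair p n X \<A> H"
    and "standard_generators p n X H a"
    and "\<And>r. r \<ge> 1 \<Longrightarrow> is_ordering p r (u r)"
    and "subgroup K (transformation_group X H)"
    and "K \<noteq> {\<one>\<^bsub>transformation_group X H\<^esub>}"
  shows "acts_freely X K \<longleftrightarrow>
    (\<exists>r \<in> admissible_ranks p n u. \<exists>P \<in> partition_tuples p n r (u r).
       K = kernel_of_partition p X H a r (u r) P)"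
proof -
  define G where "G = transformation_group X H"
  have one_G: "\<one>\<^bsub>BijGroup (topspace X)\<^esub> = \<one>\<^bsub>G\<^esub>" and carrier_G: "carrier G = H"
    by (simp_all add: G_def)
  have p: "p > 1"
    using assms(1) by (rule prime_gt_1_nat)
  have "subgroup H (BijGroup (topspace X))" and iso: "G \<cong> Zpow p n"
    using assms(4) by (auto simp: generalized_Fermat_pair_def conformal_group_on_def G_def)
  then have grp: "group G"
    unfolding G_def by (metis group.subgroup_imp_group group_BijGroup)
  obtain h where "h \<in> iso (Zpow p n) G"
    using group.iso_sym [OF grp iso] by (auto simp: is_iso_def)
  then interpret elementary_abelian_group G p
    by (intro elementary_abelian_hom_image [OF elementary_abelian_Zpow [OF assms(1), of n] grp, of h])
      (auto simp: Group.iso_iff)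
  have card: "card (carrier G) = p ^ n"
    using iso_same_card [OF iso] p by (simp add: card_carrier_Zpow)
  have fin: "finite (carrier G)"
    using card p by (metis card.infinite not_one_less_zero power_not_zero)
  have a: "a ` {1..n + 1} \<subseteq> carrier G" "(\<Otimes>\<^bsub>G\<^esub>j\<in>{1..n + 1}. a j) = \<one>\<^bsub>G\<^esub>"
    and gen: "generate G (a ` {1..n}) = carrier G"
    and ord_a: "\<And>j. j \<in> {1..n + 1} \<Longrightarrow> ord (a j) = p"
    and fixed_powers: "\<And>h. h \<in> H \<Longrightarrow> h \<noteq> \<one>\<^bsub>G\<^esub> \<Longrightarrow> has_fixed_point X h \<Longrightarrow>
      \<exists>j \<in> {1..n + 1}. \<exists>m::int. h = a j [^]\<^bsub>G\<^esub> m"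
    and fixed_a: "\<And>j. j \<in> {1..n + 1} \<Longrightarrow> has_fixed_point X (a j)"
    using assms(5) unfolding standard_generators_def Let_def G_def [symmetric] carrier_G by auto
  have K: "subgroup K G"
    using assms(7) by (simp add: G_def)
  note ex1 = ex1_epi_partition [OF a gen card]
  have rho_eq: "rho p X H a r (u r) P = (THE f. f \<in> extensional (carrier G) \<and> f \<in> epi G (Zpow p r) \<and>
      (\<forall>k\<in>{1..p ^ r - 1}. \<forall>j\<in>P k. f (a j) = u r k))" for r P
    by (simp add: rho_def G_def)
  show ?thesis
  proof
    assume free: "acts_freely X K"
    \<comment> \<open>Each \<open>a j\<close> has a fixed point and is non-trivial, its order being
      \<open>p > 1\<close>.\<close>
    have notin: "a j \<notin> K" if j: "j \<in> {1..n + 1}" for j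
    proof
      assume "a j \<in> K"
      moreover have "a j \<noteq> \<one>\<^bsub>G\<^esub>"
        using ord_a [OF j] p by auto
      ultimately show False
        using free fixed_a [OF j] by (auto simp: acts_freely_def one_G)
    qed
    obtain r f where f: "f \<in> extensional (carrier G)" "f \<in> epi G (Zpow p r)"
      and ker: "kernel G (Zpow p r) f = K" and "p ^ r * card K = card (carrier G)"
      using subgroup_eq_kernel [OF fin K] by metis
    interpret Z: elementary_abelian_group "Zpow p r" p
      using assms(1) by (rule elementary_abelian_Zpow)
    interpret f: group_hom G "Zpow p r" f
      using f by unfold_locales (simp add: epi_def)
    have fa: "f (a j) \<in> carrier (Zpow p r)" "f (a j) \<noteq> \<one>\<^bsub>Zpow p r\<^esub>" if "j \<in> {1..n + 1}" for j
    proof -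
      have "a j \<in> carrier G"
        using a(1) that by blast
      then show "f (a j) \<in> carrier (Zpow p r)" "f (a j) \<noteq> \<one>\<^bsub>Zpow p r\<^esub>"
        using notin [OF that] ker by (auto simp: kernel_def)
    qed
    \<comment> \<open>A trivial target would send \<open>a 1\<close> to the identity.\<close>
    have "r \<noteq> 0"
    proof
      assume "r = 0"
      then have "carrier (Zpow p r) = {\<one>\<^bsub>Zpow p r\<^esub>}"
        using p by (simp add: carrier_Zpow one_Zpow restrict_def)
      then show False
        using fa [of 1] by simp
    qed
    \<comment> \<open>The index of \<open>K\<close> is \<open>p ^ r\<close>; since \<open>K\<close>
      is non-trivial, it is smaller than \<open>p ^ n\<close>, which gives
      \<open>r < n\<close>.\<close>
    have "card K \<noteq> 1"
      using assms(8) K by (metis G_def card_1_singletonE singletonD subgroup.one_closed)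
    moreover have "card K \<noteq> 0"
      using \<open>p ^ r * card K = card (carrier G)\<close> card p
      by (metis mult_is_0 not_one_less_zero power_not_zero)
    ultimately have "p ^ r * 1 < p ^ r * card K"
      using p by (intro mult_strict_left_mono) auto
    then have "r < n"
      using \<open>p ^ r * card K = card (carrier G)\<close> card p by simp
    have u: "is_ordering p r (u r)"
      using \<open>r \<noteq> 0\<close> assms(6) by simp
    let ?J = "{1..p ^ r - 1}"
    \<comment> \<open>The fibres of \<open>j \<mapsto> f (a j)\<close>, labelled through the
      ordering. Index 0 may be left out because no \<open>f (a j)\<close> is trivial.\<close>
    define P where "P = (\<lambda>k\<in>?J. {j \<in> {1..n + 1}. f (a j) = u r k})"
    have faP: "\<forall>k\<in>?J. \<forall>j\<in>P k. f (a j) = u r k"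
      by (simp add: P_def)
    have disj: "disjoint_family_on P ?J"
    proof -
      have "inj_on (u r) ?J"
        using u unfolding is_ordering_def bij_betw_def by (auto elim: inj_on_subset)
      then show ?thesis
        by (auto simp: disjoint_family_on_def P_def inj_on_def)
    qed
    have UN: "(\<Union>k\<in>?J. P k) = {1..n + 1}"
    proof
      show "{1..n + 1} \<subseteq> (\<Union>k\<in>?J. P k)"
      proof
        fix j assume j: "j \<in> {1..n + 1}"
        then obtain k where k: "k \<in> {0..p ^ r - 1}" "f (a j) = u r k"
          using fa(1) u unfolding is_ordering_def bij_betw_def by blast
        moreover have "k \<noteq> 0"
          using fa(2) [OF j] k u by (metis is_ordering_def)
        ultimately show "j \<in> (\<Union>k\<in>?J. P k)"
          using j by (auto simp: P_def)
      qed
    qed (auto simp: P_def)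
    have image: "u r ` {k \<in> ?J. P k \<noteq> {}} = f ` a ` {1..n + 1}"
      unfolding image_image using faP by (intro image_constant_on_parts [OF UN]) blast
    have uJ: "u r ` ?J \<subseteq> carrier (Zpow p r)"
      using is_ordering_closed [OF u] by auto
    have "(\<Otimes>\<^bsub>Zpow p r\<^esub>k\<in>?J. u r k [^]\<^bsub>Zpow p r\<^esub> card (P k)) = (\<Otimes>\<^bsub>Zpow p r\<^esub>j\<in>{1..n + 1}. f (a j))"
      using Z.finprod_constant_on_parts [OF _ disj _ UN uJ, of "\<lambda>j. f (a j)"] faP by simp
    also have "\<dots> = f (\<Otimes>\<^bsub>G\<^esub>j\<in>{1..n + 1}. a j)"
      using a by (intro f.hom_finprod [symmetric] comm_group_axioms Z.comm_group_axioms) auto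
    finally have rel: "(\<Otimes>\<^bsub>Zpow p r\<^esub>k\<in>?J. u r k [^]\<^bsub>Zpow p r\<^esub> card (P k)) = \<one>\<^bsub>Zpow p r\<^esub>"
      using a by simp
    \<comment> \<open>The tuple sees all \<open>n + 1\<close> generators, whereas \<open>gen\<close>
      speaks of the first \<open>n\<close>.\<close>
    have "generate G (a ` {1..n + 1}) = carrier G"
    proof
      show "carrier G \<subseteq> generate G (a ` {1..n + 1})"
        unfolding gen [symmetric] by (rule mono_generate) auto
    qed (use a(1) generate_incl in blast)
    then have "generate (Zpow p r) (u r ` {k \<in> ?J. P k \<noteq> {}}) = carrier (Zpow p r)"
      unfolding image using f.generate_img [OF a(1)] f by (simp add: epi_def)
    moreover have "P \<in> ?J \<rightarrow>\<^sub>E Pow {1..n + 1}"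
      by (auto simp: P_def)
    ultimately have P: "P \<in> partition_tuples p n r (u r)"
      using disj UN rel by (simp add: partition_tuples_def)
    then have "r \<in> admissible_ranks p n u"
      using \<open>r \<noteq> 0\<close> \<open>r < n\<close> by (auto simp: admissible_ranks_def)
    \<comment> \<open>By uniqueness \<open>rho\<close> is the given \<open>f\<close>, whose kernel
      is \<open>K\<close>.\<close>
    moreover have "rho p X H a r (u r) P = f"
      unfolding rho_eq by (rule the1_equality [OF ex1 [OF u P]]) (use f faP in blast)
    then have "K = kernel_of_partition p X H a r (u r) P"
      using ker by (simp add: kernel_of_partition_def G_def)
    ultimately show "\<exists>r \<in> admissible_ranks p n u. \<exists>P \<in> partition_tuples p n r (u r).
       K = kernel_of_partition p X H a r (u r) P"
      using P by blast
  next
    assume "\<exists>r \<in> admissible_ranks p n u. \<exists>P \<in> partition_tuples p n r (u r).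
       K = kernel_of_partition p X H a r (u r) P"
    then obtain r P where r: "r \<in> admissible_ranks p n u" and P: "P \<in> partition_tuples p n r (u r)"
      and ker: "K = kernel_of_partition p X H a r (u r) P"
      by blast
    define f where "f = rho p X H a r (u r) P"
    have u: "is_ordering p r (u r)"
      using r assms(6) by (simp add: admissible_ranks_def)
    have faP: "\<forall>k\<in>{1..p ^ r - 1}. \<forall>j\<in>P k. f (a j) = u r k"
      using theI' [OF ex1 [OF u P]] unfolding f_def rho_eq by blast
    \<comment> \<open>The part containing \<open>j\<close> has a label \<open>k \<ge> 1\<close>, so
      \<open>f\<close> sends \<open>a j\<close> to a non-trivial element.\<close>
    have notin: "a j \<notin> K" if "j \<in> {1..n + 1}" for j
    proof -
      obtain k where k: "k \<in> {1..p ^ r - 1}" "j \<in> P k"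
        using P \<open>j \<in> {1..n + 1}\<close> by (rule partition_tuples_cover)
      then have "f (a j) = u r k"
        using faP by simp
      then have "f (a j) \<noteq> \<one>\<^bsub>Zpow p r\<^esub>"
        using is_ordering_neq_one [OF u k(1)] by simp
      then show ?thesis
        by (simp add: ker kernel_of_partition_def kernel_def f_def)
    qed
    show "acts_freely X K"
      unfolding acts_freely_def one_G
    proof (intro ballI impI notI)
      fix x assume x: "x \<in> K" "x \<noteq> \<one>\<^bsub>G\<^esub>" "has_fixed_point X x"
      then have "x \<in> H"
        using subgroup.subset [OF K] carrier_G by auto
      then obtain j and m :: int where j: "j \<in> {1..n + 1}" and "x = a j [^]\<^bsub>G\<^esub> m"
        using fixed_powers x by blast
      moreover have aj: "a j \<in> carrier G"
        using a(1) j by blast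
      \<comment> \<open>Reducing the exponent modulo \<open>p\<close> brings it into the range where
        a power in \<open>K\<close> forces \<open>a j\<close> into \<open>K\<close>; it is non-zero
        because \<open>x\<close> is non-trivial.\<close>
      ultimately have pow: "x = a j [^]\<^bsub>G\<^esub> (m mod int p)"
        by (simp add: int_pow_mod)
      then have "m mod int p \<noteq> 0"
        using x(2) by auto
      then have "0 < m mod int p" "m mod int p < int p"
        using p pos_mod_sign [of "int p" m] pos_mod_bound [of "int p" m] by linarith+
      then have "a j \<in> K"
        using subgroup_int_pow_cancel [OF K aj] x(1) pow by blast
      then show False
        using notin j by blast
    qed
  qed
qed

end
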